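(* Let $n,K\in\mathbb{N}$ and let $A\in\mathbb{R}^{n\times n}$ be entrywise nonnegative. For a control schedule $(\iota_0,\dots,\iota_{K-1})\in\{1,\dots,n\}^K$ let $\mathcal{W}_K=\mathcal{W}_K(\iota_0,\dots,\iota_{K-1})$ be the associated controllability Gramian, and for $i\in\{1,\dots,n\}$, $k\ge 0$ let $R_i(k)=((A^k)^TA^k)_{ii}$. For each $k\in\{0,\dots,K-1\}$ let $r(k)\in\arg\max_{1\le i\le n}R_i(k)$. Then the schedule $$\iota_k^*=r(K-1-k),\qquad k\in\{0,\dots,K-1\},$$ is a solution of the time-varying control scheduling problem $$\max_{\iota_0,\dots,\iota_{K-1}\in\{1,\dots,n\}}\operatorname{tr}(\mathcal{W}_K).$$
   Context: The network dynamics are $x(k+1)=Ax(k)+b(k)u(k)$, $k\in\{0,\dots,K-1\}$, with state $x(k)\in\mathbb{R}^n$ and scalar input $u(k)$, where $b(k)\in\mathbb{R}^n$ is the $\iota_k$-th column of the $n\times n$ identity matrix ($\iota_k$ is the node controlled at time $k$). The controllability Gramian is $$\mathcal{W}_K=\sum_{k=0}^{K-1}A^k\,b(K-1-k)\,b(K-1-k)^T(A^T)^k .$$ $R_i(k)$ is called the $2k$-communicability of node $i$. *)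

theory Defs
  imports "HOL-Analysis.Analysis"
begin

text \<open>The library operation \<open>A ^ k\<close> on \<open>real ^ 'n ^ 'n\<close> is the componentwise power, so the
  power with respect to the matrix product is defined here.\<close>

primrec matrix_power :: "real ^ 'n ^ 'n \<Rightarrow> nat \<Rightarrow> real ^ 'n ^ 'n" where
  "matrix_power A 0 = mat 1"
| "matrix_power A (Suc k) = A ** matrix_power A k"

definition input_vector :: "(nat \<Rightarrow> 'n) \<Rightarrow> nat \<Rightarrow> real ^ 'n" where
  "input_vector \<iota> k = column (\<iota> k) (mat 1)"

text \<open>The type constraint fixes the inner dimension of the outer product \<open>b b\<^sup>T\<close> to be 1;
  \<^const>\<open>columnvector\<close> alone is polymorphic in the number of (repeated) columns.\<close>

definition gramian :: "real ^ 'n ^ 'n \<Rightarrow> nat \<Rightarrow> (nat \<Rightarrow> 'n) \<Rightarrow> real ^ 'n ^ 'n" where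
  "gramian A K \<iota> =
    (\<Sum>k<K. matrix_power A k
       ** (columnvector (input_vector \<iota> (K - 1 - k)) :: real ^ 1 ^ 'n)
       ** transpose (columnvector (input_vector \<iota> (K - 1 - k)) :: real ^ 1 ^ 'n)
       ** matrix_power (transpose A) k)"

definition communicability :: "real ^ 'n ^ 'n \<Rightarrow> 'n \<Rightarrow> nat \<Rightarrow> real" where
  "communicability A i k = (transpose (matrix_power A k) ** matrix_power A k) $ i $ i"

text \<open>A schedule \<open>(\<iota>\<^sub>0, \<dots>, \<iota>\<^sub>K\<^sub>-\<^sub>1)\<close> is an extensional function on \<open>{..<K}\<close>: it is
  \<^const>\<open>undefined\<close> outside.\<close>

definition schedules :: "nat \<Rightarrow> (nat \<Rightarrow> 'n) set" where
  "schedules K = {..<K} \<rightarrow>\<^sub>E UNIV"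

end

theory Submission
  imports Defs
begin

text \<open>The trace decouples the schedule. With \<open>P = A\<^sup>k\<close> and \<open>e\<close> the unit vector of the node
  controlled at time \<open>K - 1 - k\<close>, the \<open>k\<close>-th summand of the Gramian is \<open>(P e) (P e)\<^sup>T\<close>, whose
  trace is the squared norm of a column of \<open>P\<close>, that is, a diagonal entry of \<open>P\<^sup>T P\<close>. So the
  objective is a sum of \<open>2k\<close>-communicabilities, one for each \<open>k\<close>, of independently
  chosen nodes (\<open>trace_gramian\<close>), and it is maximal as soon as each summand is.\<close>

lemma matrix_power_commute: "matrix_power A k ** A = A ** matrix_power A k"
  by (induction k) (simp_all add: matrix_mul_assoc[symmetric])

text \<open>Transposition reverses products, so the induction needs a power to be unrolled at either
  end.\<close>

lemma matrix_power_transpose: "matrix_power (transpose A) k = transpose (matrix_power A k)"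
  by (induction k) (simp_all add: matrix_transpose_mul[symmetric] matrix_power_commute)

lemma matrix_mul_unit_columnvector:
  fixes P :: "real ^ 'n ^ 'n"
  shows "(P ** columnvector (column i (mat 1))) $ a $ b = P $ a $ i"
  by (simp add: matrix_matrix_mult_def columnvector_def column_def mat_def if_distrib cong: if_cong)

lemma trace_rank_one_term:
  fixes P :: "real ^ 'n ^ 'n" and i :: 'n
  defines "b \<equiv> columnvector (column i (mat 1)) :: real ^ 1 ^ 'n"
  shows "trace (P ** b ** transpose b ** transpose P) = (transpose P ** P) $ i $ i"
proof -
  define C where "C = P ** b"
  have "C $ a $ c = P $ a $ i" for a c
    unfolding C_def b_def by (rule matrix_mul_unit_columnvector)
  then have "trace (C ** transpose C) = (transpose P ** P) $ i $ i"
    by (simp add: trace_def matrix_matrix_mult_def transpose_def)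
  moreover have "P ** b ** transpose b ** transpose P = C ** transpose C"
    unfolding C_def matrix_transpose_mul by (simp only: matrix_mul_assoc)
  ultimately show ?thesis by simp
qed

lemma trace_sum:
  fixes f :: "'k \<Rightarrow> 'a::comm_semiring_1 ^ 'n ^ 'n"
  shows "trace (\<Sum>k\<in>S. f k) = (\<Sum>k\<in>S. trace (f k))"
  unfolding trace_def sum_component by (rule sum.swap)

lemma trace_gramian: "trace (gramian A K \<iota>) = (\<Sum>k<K. communicability A (\<iota> (K - 1 - k)) k)"
  by (simp add: gramian_def trace_sum matrix_power_transpose input_vector_def
      trace_rank_one_term communicability_def)

theorem mainTheorem1:
  fixes A :: "real ^ 'n ^ 'n" and K :: nat and r :: "nat \<Rightarrow> 'n"
  assumes "\<And>i j. 0 \<le> A $ i $ j"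
    and "\<And>k. k < K \<Longrightarrow> is_arg_max (\<lambda>i. communicability A i k) (\<lambda>i. i \<in> UNIV) (r k)"
  shows "is_arg_max (\<lambda>\<iota>. trace (gramian A K \<iota>)) (\<lambda>\<iota>. \<iota> \<in> schedules K)
           (\<lambda>k\<in>{..<K}. r (K - 1 - k))"
proof -
  let ?s = "\<lambda>k\<in>{..<K}. r (K - 1 - k)"
  have best: "communicability A i k \<le> communicability A (r k) k" if "k < K" for i k
    using assms(2)[OF that] by (simp add: is_arg_max_linorder)
  have "trace (gramian A K \<iota>) \<le> trace (gramian A K ?s)" for \<iota>
    unfolding trace_gramian
  proof (rule sum_mono)
    fix k assume "k \<in> {..<K}"
    \<comment> \<open>The time reversal in the Gramian undoes the one in the schedule.\<close>
    then have "?s (K - 1 - k) = r k" by simp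
    then show "communicability A (\<iota> (K - 1 - k)) k \<le> communicability A (?s (K - 1 - k)) k"
      using best \<open>k \<in> {..<K}\<close> by simp
  qed
  then show ?thesis
    by (simp add: is_arg_max_linorder schedules_def)
qed

end
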